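(* Let $\mathbb{F}$ be a field with $\mathrm{Char}(\mathbb{F})\ne2$. Let $a_0,a_1,x_1,\theta^*_0,\theta^*_1\in\mathbb{F}$ and consider the matrices in $\mathrm{Mat}_2(\mathbb{F})$ $$A=\begin{pmatrix}a_0&x_1\\1&a_1\end{pmatrix},\qquad B=\begin{pmatrix}0&x_1\\1&0\end{pmatrix},\qquad A^*=\begin{pmatrix}\theta^*_0&0\\0&\theta^*_1\end{pmatrix}.$$ Let $\theta_0,\theta_1$ denote the roots, in the algebraic closure of $\mathbb{F}$, of the characteristic polynomial $\lambda^2-(a_0+a_1)\lambda+a_0a_1-x_1$ of $A$. Assume that the pair $B,A^*$ is a Leonard pair over $\mathbb{F}$. Then the following are equivalent: (i) $A,A^*$ is a near-bipartite expansion of $B,A^*$; (ii) $A,A^*$ is a Leonard pair over $\mathbb{F}$; (iii) $\theta_0,\theta_1\in\mathbb{F}$ and $(a_0-a_1)^2+4x_1\neq0$.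
   Context: A tridiagonal matrix is irreducible if all its subdiagonal and superdiagonal entries are nonzero. Let $V$ be a vector space over $\mathbb{F}$ of dimension $d+1$. A Leonard pair on $V$ (over $\mathbb{F}$) is an ordered pair $A,A^*$ in $\mathrm{End}(V)$ such that (a) some basis of $V$ makes the matrix of $A$ irreducible tridiagonal and that of $A^*$ diagonal; (b) some basis of $V$ makes the matrix of $A^*$ irreducible tridiagonal and that of $A$ diagonal. ($A^*$ is just a name, not an adjoint.) Here $V=\mathbb{F}^2$ and matrices act by left multiplication. Each of $A,A^*$ has $d+1$ distinct eigenvalues. Let $E^*_0,\dots,E^*_d$ be the primitive idempotents of $A^*$ (projections onto its eigenspaces along the sum of the other eigenspaces). The flat part of $A$ is $F=\sum_{i=0}^d E^*_i A E^*_i$. $A,A^*$ is bipartite if $F=0$, and near-bipartite if $A-F,A^*$ is a Leonard pair on $V$; in that case $A-F,A^*$ is a bipartite Leonard pair called the bipartite contraction of $A,A^*$. A near-bipartite expansion of a bipartite Leonard pair $B,A^*$ on $V$ is a near-bipartite Leonard pair $A,A^*$ on $V$ whose bipartite contraction equals $B,A^*$. *)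

theory Defs
  imports "HOL-Analysis.Cartesian_Space" "HOL-Algebra.Algebraic_Closure_Type"
begin

text \<open>
  An \<open>n \<times> n\<close> matrix with \<open>n = d + 1\<close> is a function \<open>M :: nat \<Rightarrow> nat \<Rightarrow> 'a\<close>, of which only the
  entries \<open>M i j\<close> with \<open>i, j \<le> d\<close> matter (row \<open>i\<close>, column \<open>j\<close>).
\<close>

definition diagonal_matrix :: "nat \<Rightarrow> (nat \<Rightarrow> nat \<Rightarrow> 'a::zero) \<Rightarrow> bool" where
  "diagonal_matrix d M \<longleftrightarrow> (\<forall>i\<le>d. \<forall>j\<le>d. i \<noteq> j \<longrightarrow> M i j = 0)"

definition tridiagonal_matrix :: "nat \<Rightarrow> (nat \<Rightarrow> nat \<Rightarrow> 'a::zero) \<Rightarrow> bool" where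
  "tridiagonal_matrix d M \<longleftrightarrow> (\<forall>i\<le>d. \<forall>j\<le>d. Suc i < j \<or> Suc j < i \<longrightarrow> M i j = 0)"

definition irreducible_tridiagonal_matrix :: "nat \<Rightarrow> (nat \<Rightarrow> nat \<Rightarrow> 'a::zero) \<Rightarrow> bool" where
  "irreducible_tridiagonal_matrix d M \<longleftrightarrow>
     tridiagonal_matrix d M \<and> (\<forall>i<d. M (Suc i) i \<noteq> 0 \<and> M i (Suc i) \<noteq> 0)"

context vector_space
begin

text \<open>The vector space is the whole type \<open>'b\<close>; an ordered basis is \<open>v 0, \<dots>, v d\<close>.
  The prefix \<open>local\<close> avoids capture by the global interpretation for real vector spaces.\<close>

definition ordered_basis :: "nat \<Rightarrow> (nat \<Rightarrow> 'b) \<Rightarrow> bool" where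
  "ordered_basis d v \<longleftrightarrow>
     inj_on v {..d} \<and> independent (v ` {..d}) \<and> span (v ` {..d}) = UNIV"

definition matrix_wrt :: "nat \<Rightarrow> (nat \<Rightarrow> 'b) \<Rightarrow> ('b \<Rightarrow> 'b) \<Rightarrow> nat \<Rightarrow> nat \<Rightarrow> 'a" where
  "matrix_wrt d v f i j = representation (v ` {..d}) (f (v j)) (v i)"

text \<open>
  The existence of an ordered basis \<open>v 0, \<dots>, v d\<close> makes the dimension of the space \<open>d + 1\<close>.
\<close>

definition leonard_pair :: "nat \<Rightarrow> ('b \<Rightarrow> 'b) \<Rightarrow> ('b \<Rightarrow> 'b) \<Rightarrow> bool" where
  "leonard_pair d A As \<longleftrightarrow>
     Vector_Spaces.linear scale scale A \<and> Vector_Spaces.linear scale scale As \<and>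
     (\<exists>v. local.ordered_basis d v \<and> irreducible_tridiagonal_matrix d (local.matrix_wrt d v A) \<and>
          diagonal_matrix d (local.matrix_wrt d v As)) \<and>
     (\<exists>v. local.ordered_basis d v \<and> irreducible_tridiagonal_matrix d (local.matrix_wrt d v As) \<and>
          diagonal_matrix d (local.matrix_wrt d v A))"

definition eigenspace :: "('b \<Rightarrow> 'b) \<Rightarrow> 'a \<Rightarrow> 'b set" where
  "eigenspace f \<theta> = {x. f x = scale \<theta> x}"

definition eigenvalues :: "('b \<Rightarrow> 'b) \<Rightarrow> 'a set" where
  "eigenvalues f = {\<theta>. local.eigenspace f \<theta> \<noteq> {0}}"

text \<open>
  For diagonalizable \<open>f\<close>, \<open>primitive_idempotent f \<theta>\<close> is the projection onto the eigenspace of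
  \<open>\<theta>\<close> along the sum of the other eigenspaces. Primitive idempotents are indexed by eigenvalues;
  the flat part does not depend on how these are ordered.
\<close>

definition primitive_idempotent :: "('b \<Rightarrow> 'b) \<Rightarrow> 'a \<Rightarrow> 'b \<Rightarrow> 'b" where
  "primitive_idempotent f \<theta> x =
     (THE y. y \<in> local.eigenspace f \<theta> \<and>
             x - y \<in> span (\<Union>\<mu>\<in>local.eigenvalues f - {\<theta>}. local.eigenspace f \<mu>))"

definition flat_part :: "('b \<Rightarrow> 'b) \<Rightarrow> ('b \<Rightarrow> 'b) \<Rightarrow> 'b \<Rightarrow> 'b" where
  "flat_part A As x =
     (\<Sum>\<theta>\<in>local.eigenvalues As.
        local.primitive_idempotent As \<theta> (A (local.primitive_idempotent As \<theta> x)))"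

definition bipartite_leonard_pair :: "nat \<Rightarrow> ('b \<Rightarrow> 'b) \<Rightarrow> ('b \<Rightarrow> 'b) \<Rightarrow> bool" where
  "bipartite_leonard_pair d A As \<longleftrightarrow> local.leonard_pair d A As \<and> local.flat_part A As = (\<lambda>x. 0)"

text \<open>The first component of the bipartite contraction \<open>A - F, As\<close> of \<open>A, As\<close>.\<close>

definition bipartite_contraction :: "('b \<Rightarrow> 'b) \<Rightarrow> ('b \<Rightarrow> 'b) \<Rightarrow> 'b \<Rightarrow> 'b" where
  "bipartite_contraction A As = (\<lambda>x. A x - local.flat_part A As x)"

definition near_bipartite_leonard_pair :: "nat \<Rightarrow> ('b \<Rightarrow> 'b) \<Rightarrow> ('b \<Rightarrow> 'b) \<Rightarrow> bool" where
  "near_bipartite_leonard_pair d A As \<longleftrightarrow>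
     local.leonard_pair d A As \<and> local.leonard_pair d (local.bipartite_contraction A As) As"

text \<open>\<open>A, As\<close> is a near-bipartite expansion of the bipartite Leonard pair \<open>B, As\<close>.\<close>

definition near_bipartite_expansion ::
    "nat \<Rightarrow> ('b \<Rightarrow> 'b) \<Rightarrow> ('b \<Rightarrow> 'b) \<Rightarrow> ('b \<Rightarrow> 'b) \<Rightarrow> bool" where
  "near_bipartite_expansion d A B As \<longleftrightarrow>
     local.bipartite_leonard_pair d B As \<and> local.near_bipartite_leonard_pair d A As \<and>
     local.bipartite_contraction A As = B"

end

end

theory Submission
  imports Defs
begin

text \<open>
  In dimension two, everything can be expressed through the form \<open>p \<and> q = p\<^sub>1 q\<^sub>2 - p\<^sub>2 q\<^sub>1\<close>: two vectors
  form a basis iff \<open>p \<and> q \<noteq> 0\<close>, and the off-diagonal entries of a map \<open>f\<close> in that basis are, up to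
  a nonzero factor, \<open>p \<and> f p\<close> and \<open>q \<and> f q\<close>. Hence a Leonard pair is a pair of maps with a basis of
  eigenvectors each, no member of which is an eigenvector of the other map. For \<open>A\<close> the slopes
  \<open>p\<^sub>1 / p\<^sub>2\<close> of the eigenvectors are the roots of \<open>X\<^sup>2 - (a\<^sub>0 - a\<^sub>1) X - x\<^sub>1\<close>, which is the
  characteristic polynomial shifted by \<open>a\<^sub>1\<close>. The flat part of \<open>A\<close> is its diagonal, because the
  primitive idempotents of \<open>A\<^sup>*\<close> are the coordinate projections; so the bipartite contraction of
  \<open>A, A\<^sup>*\<close> is \<open>B, A\<^sup>*\<close>.
\<close>

section \<open>Bases and Leonard pairs on the plane in terms of the wedge form\<close>

definition wedge :: "'a::field ^ 2 \<Rightarrow> 'a ^ 2 \<Rightarrow> 'a" where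
  "wedge p q = p $ 1 * q $ 2 - p $ 2 * q $ 1"

lemma wedge_self [simp]: "wedge p p = 0"
  by (simp add: wedge_def)

lemma wedge_combination:
  "wedge (a *s p + b *s q) (c *s p + d *s q) = (a * d - b * c) * wedge p q"
  by (simp add: wedge_def algebra_simps)

lemma wedge_left: "wedge (a *s p + b *s q) q = a * wedge p q"
  and wedge_right: "wedge p (a *s p + b *s q) = b * wedge p q"
  by (simp_all add: wedge_def algebra_simps)

text \<open>Cramer's rule: the coordinates of \<open>x\<close> are quotients of
  determinants.\<close>

lemma wedge_expansion:
  fixes p q x :: "'a::field ^ 2"
  assumes "wedge p q \<noteq> 0"
  shows "x = (wedge x q / wedge p q) *s p + (wedge p x / wedge p q) *s q"
proof -
  have "wedge p q * x $ i = wedge x q * p $ i + wedge p x * q $ i" for i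
    using exhaust_2[of i] by (auto simp: wedge_def algebra_simps)
  with assms show ?thesis
    by (simp add: vec_eq_iff field_simps)
qed

lemma atMost_Suc_0_nat: "{..Suc 0} = {0, Suc 0}"
  by auto

lemma ordered_basis_1_iff_wedge:
  fixes v :: "nat \<Rightarrow> 'a::field ^ 2"
  shows "vec.ordered_basis 1 v \<longleftrightarrow> wedge (v 0) (v 1) \<noteq> 0"
proof
  assume "vec.ordered_basis 1 v"
  then have "vec.span {v 0, v 1} = UNIV"
    by (simp add: vec.ordered_basis_def atMost_Suc_0_nat)
  then have "\<exists>a b. x = a *s v 0 + b *s v 1" for x
    by (auto simp: vec.span_insert vec.span_empty algebra_simps set_eq_iff)
  then obtain a b c d where
    e1: "axis 1 1 = a *s v 0 + b *s v 1" and e2: "axis 2 1 = c *s v 0 + d *s v 1"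
    by metis
  \<comment> \<open>The standard basis has wedge 1. Writing it through \<open>v 0\<close> and
    \<open>v 1\<close> makes this 1 a multiple of \<open>wedge (v 0) (v 1)\<close>, which therefore
    cannot vanish.\<close>
  have "wedge (axis 1 1) (axis 2 1 :: 'a ^ 2) = 1"
    by (simp add: wedge_def axis_def)
  then show "wedge (v 0) (v 1) \<noteq> 0"
    unfolding e1 e2 wedge_combination by auto
next
  assume w: "wedge (v 0) (v 1) \<noteq> 0"
  then have ne: "v 0 \<noteq> v 1" by auto
  have "v 0 \<noteq> k *s v 1" for k
    using w by (auto simp: wedge_def)
  moreover have "v 1 \<noteq> 0"
    using w by (auto simp: wedge_def)
  ultimately have "vec.independent {v 0, v 1}"
    using ne by (auto simp: vec.independent_insert vec.span_insert vec.span_empty vec.dependent_single)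
  moreover have "vec.span {v 0, v 1} = UNIV"
  proof -
    have "x \<in> vec.span {v 0, v 1}" for x
      by (subst wedge_expansion[OF w, of x])
        (intro vec.span_add vec.span_scale vec.span_base; simp)
    then show ?thesis by auto
  qed
  ultimately show "vec.ordered_basis 1 v"
    using ne by (auto simp: vec.ordered_basis_def atMost_Suc_0_nat inj_on_def)
qed

text \<open>Expand \<open>f (v j)\<close> in the basis and wedge it with \<open>v j\<close>: the
  diagonal term drops out and only the off-diagonal entry of that column survives.\<close>

lemma matrix_wrt_1_offdiag:
  fixes v :: "nat \<Rightarrow> 'a::field ^ 2"
  assumes "vec.ordered_basis 1 v"
  shows "vec.matrix_wrt 1 v f 1 0 = wedge (v 0) (f (v 0)) / wedge (v 0) (v 1)"
    and "vec.matrix_wrt 1 v f 0 1 = wedge (f (v 1)) (v 1) / wedge (v 0) (v 1)"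
proof -
  have w: "wedge (v 0) (v 1) \<noteq> 0"
    using assms ordered_basis_1_iff_wedge by blast
  then have ne: "v 0 \<noteq> v 1" by auto
  have "x = vec.representation {v 0, v 1} x (v 0) *s v 0 + vec.representation {v 0, v 1} x (v 1) *s v 1"
    for x
    using vec.sum_representation_eq[of "{v 0, v 1}" x "{v 0, v 1}"] assms ne
    by (simp add: vec.ordered_basis_def atMost_Suc_0_nat)
  then have "f (v j) = vec.matrix_wrt 1 v f 0 j *s v 0 + vec.matrix_wrt 1 v f 1 j *s v 1" for j
    by (simp add: vec.matrix_wrt_def atMost_Suc_0_nat)
  then have "wedge (v 0) (f (v 0)) = vec.matrix_wrt 1 v f 1 0 * wedge (v 0) (v 1)"
    "wedge (f (v 1)) (v 1) = vec.matrix_wrt 1 v f 0 1 * wedge (v 0) (v 1)"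
    using wedge_left wedge_right by metis+
  with w show "vec.matrix_wrt 1 v f 1 0 = wedge (v 0) (f (v 0)) / wedge (v 0) (v 1)"
    "vec.matrix_wrt 1 v f 0 1 = wedge (f (v 1)) (v 1) / wedge (v 0) (v 1)"
    by simp_all
qed

lemma diagonal_irreducible_basis_1_iff_wedge:
  fixes f g :: "'a::field ^ 2 \<Rightarrow> 'a ^ 2"
  shows "(\<exists>v. vec.ordered_basis 1 v \<and> irreducible_tridiagonal_matrix 1 (vec.matrix_wrt 1 v f) \<and>
            diagonal_matrix 1 (vec.matrix_wrt 1 v g)) \<longleftrightarrow>
         (\<exists>p q. wedge p q \<noteq> 0 \<and> wedge p (f p) \<noteq> 0 \<and> wedge q (f q) \<noteq> 0 \<and>
            wedge p (g p) = 0 \<and> wedge q (g q) = 0)"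
proof -
  have swap: "wedge y x = 0 \<longleftrightarrow> wedge x y = 0" for x y :: "'a ^ 2"
    by (auto simp: wedge_def algebra_simps)
  \<comment> \<open>For \<open>d = 1\<close> no index pair is more than one apart, so tridiagonality
    is vacuous and both conditions concern only the two off-diagonal entries.\<close>
  have irr: "irreducible_tridiagonal_matrix 1 M \<longleftrightarrow> M 1 0 \<noteq> 0 \<and> M 0 1 \<noteq> 0"
    and diag: "diagonal_matrix 1 M \<longleftrightarrow> M 1 0 = 0 \<and> M 0 1 = 0" for M :: "nat \<Rightarrow> nat \<Rightarrow> 'a"
    by (auto simp: irreducible_tridiagonal_matrix_def tridiagonal_matrix_def diagonal_matrix_def
        le_Suc_eq)
  have "vec.ordered_basis 1 v \<and> irreducible_tridiagonal_matrix 1 (vec.matrix_wrt 1 v f) \<and>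
            diagonal_matrix 1 (vec.matrix_wrt 1 v g) \<longleftrightarrow>
        wedge (v 0) (v 1) \<noteq> 0 \<and> wedge (v 0) (f (v 0)) \<noteq> 0 \<and> wedge (v 1) (f (v 1)) \<noteq> 0 \<and>
            wedge (v 0) (g (v 0)) = 0 \<and> wedge (v 1) (g (v 1)) = 0" for v
    unfolding irr diag
    using matrix_wrt_1_offdiag[of v f] matrix_wrt_1_offdiag[of v g] ordered_basis_1_iff_wedge[of v]
      swap by auto
  note * = this
  show ?thesis
    unfolding *
  proof (intro iffI; elim exE)
    fix p q
    assume "wedge p q \<noteq> 0 \<and> wedge p (f p) \<noteq> 0 \<and> wedge q (f q) \<noteq> 0 \<and>
            wedge p (g p) = 0 \<and> wedge q (g q) = 0"
    then show "\<exists>v. wedge (v 0) (v 1) \<noteq> 0 \<and> wedge (v 0) (f (v 0)) \<noteq> 0 \<and> wedge (v 1) (f (v 1)) \<noteq> 0 \<and>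
            wedge (v 0) (g (v 0)) = 0 \<and> wedge (v (1::nat)) (g (v 1)) = 0"
      by (intro exI[of _ "\<lambda>i. if i = 0 then p else q"]) simp
  qed blast
qed

lemma leonard_pair_1_iff_wedge:
  fixes M N :: "'a::field ^ 2 ^ 2"
  shows "vec.leonard_pair 1 ((*v) M) ((*v) N) \<longleftrightarrow>
    (\<exists>p q. wedge p q \<noteq> 0 \<and> wedge p (M *v p) \<noteq> 0 \<and> wedge q (M *v q) \<noteq> 0 \<and>
       wedge p (N *v p) = 0 \<and> wedge q (N *v q) = 0) \<and>
    (\<exists>p q. wedge p q \<noteq> 0 \<and> wedge p (N *v p) \<noteq> 0 \<and> wedge q (N *v q) \<noteq> 0 \<and>
       wedge p (M *v p) = 0 \<and> wedge q (M *v q) = 0)"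
  unfolding vec.leonard_pair_def diagonal_irreducible_basis_1_iff_wedge
  by (simp add: matrix_vector_mul_linear_gen)

section \<open>Leonard pairs whose second matrix is diagonal\<close>

lemma mult_vec_2:
  fixes a b c d :: "'a::field"
  shows "(vector [vector [a, b], vector [c, d]] :: 'a ^ 2 ^ 2) *v p =
     vector [a * p $ 1 + b * p $ 2, c * p $ 1 + d * p $ 2]"
  by (simp add: vec_eq_iff forall_2 matrix_vector_mult_def sum_2)

lemma wedge_mult_vec_2:
  fixes a b c d :: "'a::field"
  shows "wedge p ((vector [vector [a, b], vector [c, d]] :: 'a ^ 2 ^ 2) *v p) =
     c * (p $ 1)\<^sup>2 + (d - a) * p $ 1 * p $ 2 - b * (p $ 2)\<^sup>2"
  by (simp add: mult_vec_2 wedge_def power2_eq_square algebra_simps)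

text \<open>Here \<open>s\<close> and \<open>r\<close> are the slopes of two independent
  eigenvectors of the first matrix. Vieta's formulas state that they are the roots of the slope
  polynomial, with no square root or closure involved.\<close>

lemma leonard_pair_diagonal_2_iff:
  fixes a0 a1 x1 \<theta>s0 \<theta>s1 :: "'a::field"
  shows "vec.leonard_pair 1 ((*v) (vector [vector [a0, x1], vector [1, a1]] :: 'a ^ 2 ^ 2))
           ((*v) (vector [vector [\<theta>s0, 0], vector [0, \<theta>s1]])) \<longleftrightarrow>
         \<theta>s0 \<noteq> \<theta>s1 \<and> x1 \<noteq> 0 \<and> (\<exists>s r. s \<noteq> r \<and> s + r = a0 - a1 \<and> s * r = - x1)"
    (is "?L \<longleftrightarrow> ?R")
proof
  assume ?L
  \<comment> \<open>\<open>p\<close>, \<open>q\<close> are eigenvectors of the diagonal matrix and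
    \<open>p'\<close>, \<open>q'\<close> of the other one; the values of the quadratic forms record
    this.\<close>
  then obtain p q p' q' :: "'a ^ 2" where
    pq: "wedge p q \<noteq> 0"
      "(p $ 1)\<^sup>2 + (a1 - a0) * p $ 1 * p $ 2 - x1 * (p $ 2)\<^sup>2 \<noteq> 0"
      "(q $ 1)\<^sup>2 + (a1 - a0) * q $ 1 * q $ 2 - x1 * (q $ 2)\<^sup>2 \<noteq> 0"
      "(\<theta>s1 - \<theta>s0) * p $ 1 * p $ 2 = 0" "(\<theta>s1 - \<theta>s0) * q $ 1 * q $ 2 = 0" and
    pq': "wedge p' q' \<noteq> 0" "(\<theta>s1 - \<theta>s0) * p' $ 1 * p' $ 2 \<noteq> 0"
      "(\<theta>s1 - \<theta>s0) * q' $ 1 * q' $ 2 \<noteq> 0"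
      "(p' $ 1)\<^sup>2 + (a1 - a0) * p' $ 1 * p' $ 2 - x1 * (p' $ 2)\<^sup>2 = 0"
      "(q' $ 1)\<^sup>2 + (a1 - a0) * q' $ 1 * q' $ 2 - x1 * (q' $ 2)\<^sup>2 = 0"
    unfolding leonard_pair_1_iff_wedge wedge_mult_vec_2
    by (simp only: mult_1 mult_zero_left add_0_left diff_zero) blast
  have \<theta>: "\<theta>s0 \<noteq> \<theta>s1" using pq'(2) by auto
  \<comment> \<open>With \<open>x1 = 0\<close> the form is divisible by the first coordinate, so
    \<open>p\<close> and \<open>q\<close> would both lie on the first axis.\<close>
  have "x1 \<noteq> 0"
  proof
    assume "x1 = 0"
    then have "p $ 1 \<noteq> 0" "q $ 1 \<noteq> 0" using pq(2,3) by auto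
    then have "p $ 2 = 0" "q $ 2 = 0" using pq(4,5) \<theta> by simp_all
    then show False using pq(1) by (simp add: wedge_def)
  qed
  \<comment> \<open>The slopes exist because \<open>p'\<close> and \<open>q'\<close>, not being
    eigenvectors of the diagonal matrix, have no zero coordinate.\<close>
  define s r where "s = p' $ 1 / p' $ 2" and "r = q' $ 1 / q' $ 2"
  have nz: "p' $ 2 \<noteq> 0" "q' $ 2 \<noteq> 0" using pq'(2,3) by auto
  have p1: "p' $ 1 = s * p' $ 2" "q' $ 1 = r * q' $ 2"
    using nz by (simp_all add: s_def r_def)
  have "(p' $ 2)\<^sup>2 * (s\<^sup>2 + (a1 - a0) * s - x1) =
      (p' $ 1)\<^sup>2 + (a1 - a0) * p' $ 1 * p' $ 2 - x1 * (p' $ 2)\<^sup>2"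
    unfolding p1 by (simp add: power2_eq_square algebra_simps)
  then have s: "s\<^sup>2 + (a1 - a0) * s - x1 = 0"
    unfolding pq'(4) mult_eq_0_iff using nz by simp
  have "(q' $ 2)\<^sup>2 * (r\<^sup>2 + (a1 - a0) * r - x1) =
      (q' $ 1)\<^sup>2 + (a1 - a0) * q' $ 1 * q' $ 2 - x1 * (q' $ 2)\<^sup>2"
    unfolding p1 by (simp add: power2_eq_square algebra_simps)
  then have r: "r\<^sup>2 + (a1 - a0) * r - x1 = 0"
    unfolding pq'(5) mult_eq_0_iff using nz by simp
  have ne: "s \<noteq> r" using pq'(1) by (auto simp: wedge_def p1)
  \<comment> \<open>Subtracting the two root equations and cancelling \<open>s - r\<close> gives the
    sum of the roots; the product then follows from one of the equations.\<close>
  have "(s - r) * (s + r - (a0 - a1)) =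
      (s\<^sup>2 + (a1 - a0) * s - x1) - (r\<^sup>2 + (a1 - a0) * r - x1)"
    by (simp add: power2_eq_square algebra_simps)
  then have sum: "s + r = a0 - a1"
    unfolding s r using ne by simp
  have "s * r + x1 = s * (s + r) - (a0 - a1) * s - (s\<^sup>2 + (a1 - a0) * s - x1)"
    by (simp add: power2_eq_square algebra_simps)
  then have "s * r = - x1"
    unfolding s sum by (simp add: eq_neg_iff_add_eq_0)
  with \<theta> \<open>x1 \<noteq> 0\<close> ne sum show ?R by blast
next
  assume ?R
  then obtain s r where sr: "\<theta>s0 \<noteq> \<theta>s1" "x1 \<noteq> 0" "s \<noteq> r" "s + r = a0 - a1" "s * r = - x1"
    by blast
  have a0: "a0 = s + r + a1"
    using sr(4) by (simp add: algebra_simps)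
  have x1: "x1 = - (s * r)"
    using sr(5) by simp
  \<comment> \<open>The quadratic form splits into linear factors. The literal coefficients
    \<open>1\<close> here and \<open>0\<close> below match the instances of
    \<open>wedge_mult_vec_2\<close>.\<close>
  have splits: "1 * x\<^sup>2 + (a1 - a0) * x * y - x1 * y\<^sup>2 = (x - s * y) * (x - r * y)" for x y
    unfolding a0 x1 by (simp add: power2_eq_square algebra_simps)
  have diag: "0 * x\<^sup>2 + (\<theta>s1 - \<theta>s0) * x * y - 0 * y\<^sup>2 = (\<theta>s1 - \<theta>s0) * x * y" for x y
    by simp
  have "s \<noteq> 0" "r \<noteq> 0"
    using sr(2,5) by auto
  \<comment> \<open>At the standard basis the split form takes the values 1 and
    \<open>s * r\<close>, both nonzero.\<close>
  then have "let p = vector [1, 0] :: 'a ^ 2; q = vector [0, 1] in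
      wedge p q \<noteq> 0 \<and>
      (p $ 1 - s * p $ 2) * (p $ 1 - r * p $ 2) \<noteq> 0 \<and>
      (q $ 1 - s * q $ 2) * (q $ 1 - r * q $ 2) \<noteq> 0 \<and>
      (\<theta>s1 - \<theta>s0) * p $ 1 * p $ 2 = 0 \<and> (\<theta>s1 - \<theta>s0) * q $ 1 * q $ 2 = 0"
    by (simp add: wedge_def)
  \<comment> \<open>The vectors of slopes \<open>s\<close> and \<open>r\<close> annihilate one
    linear factor each.\<close>
  moreover have "let p = vector [s, 1] :: 'a ^ 2; q = vector [r, 1] in
      wedge p q \<noteq> 0 \<and>
      (\<theta>s1 - \<theta>s0) * p $ 1 * p $ 2 \<noteq> 0 \<and> (\<theta>s1 - \<theta>s0) * q $ 1 * q $ 2 \<noteq> 0 \<and>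
      (p $ 1 - s * p $ 2) * (p $ 1 - r * p $ 2) = 0 \<and>
      (q $ 1 - s * q $ 2) * (q $ 1 - r * q $ 2) = 0"
    using \<open>s \<noteq> 0\<close> \<open>r \<noteq> 0\<close> sr(1,3) by (simp add: wedge_def)
  ultimately show ?L
    unfolding leonard_pair_1_iff_wedge wedge_mult_vec_2 splits diag Let_def by blast
qed

section \<open>Primitive idempotents and flat part for a diagonal matrix\<close>

lemma eigenspace_diagonal_2:
  fixes \<theta>s0 \<theta>s1 :: "'a::field"
  assumes "\<theta>s0 \<noteq> \<theta>s1"
  defines "D \<equiv> ((*v) (vector [vector [\<theta>s0, 0], vector [0, \<theta>s1]] :: 'a ^ 2 ^ 2))"
  shows "vec.eigenspace D \<theta>s0 = {x. x $ 2 = 0}"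
    and "vec.eigenspace D \<theta>s1 = {x. x $ 1 = 0}"
    and "vec.eigenvalues D = {\<theta>s0, \<theta>s1}"
proof -
  have mem: "x \<in> vec.eigenspace D t \<longleftrightarrow> (\<theta>s0 = t \<or> x $ 1 = 0) \<and> (\<theta>s1 = t \<or> x $ 2 = 0)" for x t
    by (auto simp: D_def vec.eigenspace_def mult_vec_2 vec_eq_iff forall_2)
  show e0: "vec.eigenspace D \<theta>s0 = {x. x $ 2 = 0}" and e1: "vec.eigenspace D \<theta>s1 = {x. x $ 1 = 0}"
    using assms(1) by (auto simp: mem)
  have "vec.eigenspace D t = {0}" if "t \<noteq> \<theta>s0" "t \<noteq> \<theta>s1" for t
    using that by (auto simp: mem vec_eq_iff forall_2)
  moreover have "vec.eigenspace D \<theta>s0 \<noteq> {0}"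
  proof -
    have "axis 1 1 \<in> vec.eigenspace D \<theta>s0" "axis 1 1 \<noteq> (0 :: 'a ^ 2)"
      by (simp_all add: e0 axis_def vec_eq_iff)
    then show ?thesis by auto
  qed
  moreover have "vec.eigenspace D \<theta>s1 \<noteq> {0}"
  proof -
    have "axis 2 1 \<in> vec.eigenspace D \<theta>s1" "axis 2 1 \<noteq> (0 :: 'a ^ 2)"
      by (simp_all add: e1 axis_def vec_eq_iff)
    then show ?thesis by auto
  qed
  ultimately show "vec.eigenvalues D = {\<theta>s0, \<theta>s1}"
    unfolding vec.eigenvalues_def by auto
qed

text \<open>The only other eigenspace is a coordinate axis, hence its own span. So one coordinate of
  the projection is zero and the other agrees with that of \<open>x\<close>.\<close>

lemma primitive_idempotent_diagonal_2:
  fixes \<theta>s0 \<theta>s1 :: "'a::field"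
  assumes "\<theta>s0 \<noteq> \<theta>s1"
  defines "D \<equiv> ((*v) (vector [vector [\<theta>s0, 0], vector [0, \<theta>s1]] :: 'a ^ 2 ^ 2))"
  shows "vec.primitive_idempotent D \<theta>s0 x = vector [x $ 1, 0]"
    and "vec.primitive_idempotent D \<theta>s1 x = vector [0, x $ 2]"
proof -
  note eig = eigenspace_diagonal_2[OF assms(1), folded D_def]
  have sub: "vec.subspace {x :: 'a ^ 2. x $ i = 0}" for i
    by (auto simp: vec.subspace_def)
  have diff: "{\<theta>s0, \<theta>s1} - {\<theta>s0} = {\<theta>s1}" "{\<theta>s0, \<theta>s1} - {\<theta>s1} = {\<theta>s0}"
    using assms(1) by auto
  show "vec.primitive_idempotent D \<theta>s0 x = vector [x $ 1, 0]"
    unfolding vec.primitive_idempotent_def eig diff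
    by (rule the_equality) (auto simp: eig vec.span_eq_iff[THEN iffD2, OF sub] vec_eq_iff forall_2)
  show "vec.primitive_idempotent D \<theta>s1 x = vector [0, x $ 2]"
    unfolding vec.primitive_idempotent_def eig diff
    by (rule the_equality) (auto simp: eig vec.span_eq_iff[THEN iffD2, OF sub] vec_eq_iff forall_2)
qed

lemma flat_part_diagonal_2:
  fixes a b c d \<theta>s0 \<theta>s1 :: "'a::field"
  assumes "\<theta>s0 \<noteq> \<theta>s1"
  shows "vec.flat_part ((*v) (vector [vector [a, b], vector [c, d]]))
           ((*v) (vector [vector [\<theta>s0, 0], vector [0, \<theta>s1]] :: 'a ^ 2 ^ 2)) =
         (*v) (vector [vector [a, 0], vector [0, d]])"
  using assms
  by (auto simp: fun_eq_iff vec.flat_part_def eigenspace_diagonal_2 primitive_idempotent_diagonal_2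
      mult_vec_2 vec_eq_iff forall_2)

text \<open>Adding \<open>a1\<close> to the slopes \<open>s\<close>, \<open>r\<close> turns them
  into the eigenvalues. The discriminant is \<open>(s - r)\<^sup>2\<close>, so its being nonzero
  means that the slopes differ.\<close>

lemma quadratic_splits_iff:
  fixes a0 a1 x1 :: "'a::field" and \<theta>0 \<theta>1 :: "'a alg_closure"
  assumes "map_poly to_ac [:a0 * a1 - x1, - (a0 + a1), 1:] = [:- \<theta>0, 1:] * [:- \<theta>1, 1:]"
  shows "(\<exists>s r. s \<noteq> r \<and> s + r = a0 - a1 \<and> s * r = - x1) \<longleftrightarrow>
         \<theta>0 \<in> range to_ac \<and> \<theta>1 \<in> range to_ac \<and> (a0 - a1)\<^sup>2 + 4 * x1 \<noteq> 0"
proof -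
  have sum: "\<theta>0 + \<theta>1 = to_ac (a0 + a1)" and prod: "\<theta>0 * \<theta>1 = to_ac (a0 * a1 - x1)"
    using arg_cong[OF assms, of "\<lambda>p. coeff p 1"] arg_cong[OF assms, of "\<lambda>p. coeff p 0"]
    by (simp_all add: coeff_map_poly algebra_simps)
  show ?thesis
  proof
    assume "\<exists>s r. s \<noteq> r \<and> s + r = a0 - a1 \<and> s * r = - x1"
    then obtain s r where sr: "s \<noteq> r" "s + r = a0 - a1" "s * r = - x1" by blast
    have a0: "a0 = s + r + a1"
      using sr(2) by (simp add: algebra_simps)
    have x1: "x1 = - (s * r)"
      using sr(3) by simp
    \<comment> \<open>This is the characteristic polynomial at \<open>s + a1\<close>. It vanishes
      there, so one of the roots is the image of \<open>s + a1\<close>, and the trace puts the other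
      root in the field too.\<close>
    have "(to_ac (s + a1) - \<theta>0) * (to_ac (s + a1) - \<theta>1) =
        to_ac ((s + a1)\<^sup>2) - (\<theta>0 + \<theta>1) * to_ac (s + a1) + \<theta>0 * \<theta>1"
      by (simp add: power2_eq_square algebra_simps)
    also have "\<dots> = to_ac ((s + a1)\<^sup>2 - (a0 + a1) * (s + a1) + (a0 * a1 - x1))"
      by (simp only: sum prod to_ac_add to_ac_diff to_ac_mult)
    also have "\<dots> = 0"
      by (simp add: a0 x1 power2_eq_square algebra_simps)
    finally have "\<theta>0 = to_ac (s + a1) \<or> \<theta>1 = to_ac (s + a1)" by auto
    then have "\<theta>0 \<in> range to_ac \<and> \<theta>1 \<in> range to_ac"
    proof
      assume "\<theta>0 = to_ac (s + a1)"
      moreover from this sum have "\<theta>1 = to_ac (a0 + a1 - (s + a1))"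
        unfolding to_ac_diff by (simp only: eq_diff_eq add.commute)
      ultimately show ?thesis by blast
    next
      assume "\<theta>1 = to_ac (s + a1)"
      moreover from this sum have "\<theta>0 = to_ac (a0 + a1 - (s + a1))"
        unfolding to_ac_diff by (simp only: eq_diff_eq)
      ultimately show ?thesis by blast
    qed
    moreover have "(a0 - a1)\<^sup>2 + 4 * x1 = (s - r)\<^sup>2"
      by (simp add: a0 x1 power2_eq_square algebra_simps)
    ultimately show "\<theta>0 \<in> range to_ac \<and> \<theta>1 \<in> range to_ac \<and> (a0 - a1)\<^sup>2 + 4 * x1 \<noteq> 0"
      using sr(1) by simp
  next
    assume R: "\<theta>0 \<in> range to_ac \<and> \<theta>1 \<in> range to_ac \<and> (a0 - a1)\<^sup>2 + 4 * x1 \<noteq> 0"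
    then obtain t0 t1 where t: "\<theta>0 = to_ac t0" "\<theta>1 = to_ac t1" by auto
    have "t0 + t1 = a0 + a1" and p: "t0 * t1 = a0 * a1 - x1"
      using sum prod unfolding t
      by (simp_all only: to_ac_add[symmetric] to_ac_mult[symmetric] to_ac_eq_iff)
    then have a0: "a0 = t0 + t1 - a1" and x1: "x1 = a0 * a1 - t0 * t1"
      by (simp_all add: algebra_simps)
    have "(a0 - a1)\<^sup>2 + 4 * x1 = (t0 - t1)\<^sup>2"
      unfolding x1 unfolding a0 by (simp add: power2_eq_square algebra_simps)
    then have "t0 \<noteq> t1" using R by auto
    then show "\<exists>s r. s \<noteq> r \<and> s + r = a0 - a1 \<and> s * r = - x1"
      unfolding x1 unfolding a0
      by - (rule exI[of _ "t0 - a1"], rule exI[of _ "t1 - a1"], simp add: algebra_simps)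
  qed
qed

theorem proposition9p4:
  fixes a0 a1 x1 \<theta>s0 \<theta>s1 :: "'a::field"
    and A B As :: "'a ^ 2 ^ 2"
    and \<theta>0 \<theta>1 :: "'a alg_closure"
  assumes "CHAR('a) \<noteq> 2"
    and "A = vector [vector [a0, x1], vector [1, a1]]"
    and "B = vector [vector [0, x1], vector [1, 0]]"
    and "As = vector [vector [\<theta>s0, 0], vector [0, \<theta>s1]]"
    and "map_poly to_ac [:a0 * a1 - x1, - (a0 + a1), 1:] = [:- \<theta>0, 1:] * [:- \<theta>1, 1:]"
    and "vec.leonard_pair 1 ((*v) B) ((*v) As)"
  shows "(vec.near_bipartite_expansion 1 ((*v) A) ((*v) B) ((*v) As) \<longleftrightarrow>
            vec.leonard_pair 1 ((*v) A) ((*v) As)) \<and>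
         (vec.leonard_pair 1 ((*v) A) ((*v) As) \<longleftrightarrow>
            \<theta>0 \<in> range to_ac \<and> \<theta>1 \<in> range to_ac \<and> (a0 - a1)\<^sup>2 + 4 * x1 \<noteq> 0)"
proof -
  \<comment> \<open>The criterion applied to \<open>B\<close> yields both inequalities, so for
    \<open>A\<close> only the condition on the slopes remains.\<close>
  have ne: "\<theta>s0 \<noteq> \<theta>s1" and x1: "x1 \<noteq> 0"
    using assms(6) unfolding assms(3,4) leonard_pair_diagonal_2_iff by auto
  have "vec.flat_part ((*v) B) ((*v) As) = (\<lambda>x. 0)"
    unfolding assms(3,4) flat_part_diagonal_2[OF ne]
    by (simp add: fun_eq_iff mult_vec_2 vec_eq_iff forall_2)
  moreover have "vec.bipartite_contraction ((*v) A) ((*v) As) = (*v) B"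
    unfolding assms(2,3,4) vec.bipartite_contraction_def flat_part_diagonal_2[OF ne]
    by (simp add: fun_eq_iff mult_vec_2 vec_eq_iff forall_2)
  ultimately have "vec.near_bipartite_expansion 1 ((*v) A) ((*v) B) ((*v) As) \<longleftrightarrow>
      vec.leonard_pair 1 ((*v) A) ((*v) As)"
    using assms(6)
    by (simp add: vec.near_bipartite_expansion_def vec.bipartite_leonard_pair_def
        vec.near_bipartite_leonard_pair_def)
  moreover have "vec.leonard_pair 1 ((*v) A) ((*v) As) \<longleftrightarrow>
      \<theta>0 \<in> range to_ac \<and> \<theta>1 \<in> range to_ac \<and> (a0 - a1)\<^sup>2 + 4 * x1 \<noteq> 0"
    unfolding assms(2,4) leonard_pair_diagonal_2_iff
    using ne x1 quadratic_splits_iff[OF assms(5)] by simp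
  ultimately show ?thesis by blast
qed

end
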